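(* Let $n>3$ be odd. The class $\langle L_n\cup I\rangle$ does not contain a neutrosophic Bruck loop; that is, for every positive integer $m<n$ with $\gcd(m,n)=\gcd(m-1,n)=1$, $\langle L_n(m)\cup I\rangle$ is not a neutrosophic Bruck loop.
   Context: For $n>3$ odd and $m<n$ a positive integer with $\gcd(m,n)=\gcd(m-1,n)=1$, the loop $L_n(m)$ is the set $\{e,1,2,\dots,n\}$ with operation: $e\cdot i=i\cdot e=i$ for all $i$; $i\cdot i=e$ for all $i$; and for $i,j\in\{1,\dots,n\}$, $i\neq j$, $i\cdot j$ is the element $s\in\{1,\dots,n\}$ with $s\equiv mj-(m-1)i \pmod n$. The neutrosophic loop $\langle L_n(m)\cup I\rangle$ is the set $\{e,1,\dots,n,eI,1I,\dots,nI\}$ of $2(n+1)$ distinct symbols, with the product of $L_n(m)$ on $\{e,1,\dots,n\}$ and $x\cdot(yI)=(xI)\cdot y=(xI)\cdot(yI)=(x\cdot y)I$ for $x,y\in L_n(m)$. $\langle L_n\cup I\rangle$ denotes the collection of all such $\langle L_n(m)\cup I\rangle$ for fixed $n$. A neutrosophic loop is a neutrosophic Bruck loop if (i) $(x(yx))z=x(y(xz))$ for all its elements $x,y,z$, and (ii) $(xy)^{-1}=x^{-1}y^{-1}$ for all its elements $x,y$ for which the inverses exist (an inverse of $x$ being an element $x'$ with $xx'=x'x=e$). *)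

theory Defs
  imports "HOL-Algebra.Group" "HOL-Number_Theory.Cong"
begin

text \<open>
  A loop is presented by the record type of \<open>HOL-Algebra\<close> monoids, used only for its fields
  \<open>carrier\<close>, \<open>mult\<close> and \<open>one\<close>; no associativity is involved. The values of \<open>mult\<close> outside the
  carrier are irrelevant, since all conditions below are relativised to the carrier.
\<close>

datatype elt = Unit | Idx nat

lemma ex1_residue:
  fixes n :: nat and a :: int
  assumes "n > 0"
  shows "\<exists>!s. s \<in> {1..n} \<and> [int s = a] (mod int n)"
proof (rule ex_ex1I)
  define r where "r = nat ((a - 1) mod int n) + 1"
  have "0 \<le> (a - 1) mod int n" "(a - 1) mod int n < int n"
    using assms by auto
  then have "int r = (a - 1) mod int n + 1" "r \<in> {1..n}"
    by (auto simp: r_def)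
  moreover have "[(a - 1) mod int n + 1 = (a - 1) + 1] (mod int n)"
    by (simp add: cong_def mod_simps)
  ultimately show "\<exists>s. s \<in> {1..n} \<and> [int s = a] (mod int n)"
    by (intro exI[of _ r]) simp
next
  fix s t
  assume s: "s \<in> {1..n} \<and> [int s = a] (mod int n)"
    and t: "t \<in> {1..n} \<and> [int t = a] (mod int n)"
  then have "[int s = int t] (mod int n)"
    by (meson cong_sym cong_trans)
  then have "[int s - 1 = int t - 1] (mod int n)"
    by (intro cong_diff cong_refl)
  then have "int s - 1 = int t - 1"
    using s t by (auto simp: cong_def)
  then show "s = t" by simp
qed

text \<open>The residue is unique by the lemma above, so the description operator is well defined.\<close>

fun L_mult :: "nat \<Rightarrow> nat \<Rightarrow> elt \<Rightarrow> elt \<Rightarrow> elt" where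
  "L_mult n m Unit y = y"
| "L_mult n m (Idx i) Unit = Idx i"
| "L_mult n m (Idx i) (Idx j) =
     (if i = j then Unit
      else Idx (THE s. s \<in> {1..n} \<and>
                  [int s = int m * int j - (int m - 1) * int i] (mod int n)))"

definition L :: "nat \<Rightarrow> nat \<Rightarrow> elt monoid" where
  "L n m = \<lparr>carrier = insert Unit (Idx ` {1..n}), monoid.mult = L_mult n m, one = Unit\<rparr>"

text \<open>\<open>Pure x\<close> is the element \<open>x\<close> of the underlying loop and \<open>Indet x\<close> is the symbol \<open>xI\<close>.\<close>

datatype 'a neutro = Pure 'a | Indet 'a

fun neutro_mult :: "('a \<Rightarrow> 'a \<Rightarrow> 'a) \<Rightarrow> 'a neutro \<Rightarrow> 'a neutro \<Rightarrow> 'a neutro" where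
  "neutro_mult f (Pure x) (Pure y) = Pure (f x y)"
| "neutro_mult f (Pure x) (Indet y) = Indet (f x y)"
| "neutro_mult f (Indet x) (Pure y) = Indet (f x y)"
| "neutro_mult f (Indet x) (Indet y) = Indet (f x y)"

definition neutrosophic_loop :: "'a monoid \<Rightarrow> 'a neutro monoid" where
  "neutrosophic_loop G =
     \<lparr>carrier = Pure ` carrier G \<union> Indet ` carrier G,
      monoid.mult = neutro_mult (monoid.mult G),
      one = Pure (monoid.one G)\<rparr>"

definition neutrosophic_L_class :: "nat \<Rightarrow> elt neutro monoid set" where
  "neutrosophic_L_class n =
     {neutrosophic_loop (L n m) | m. 0 < m \<and> m < n \<and> gcd m n = 1 \<and> gcd (m - 1) n = 1}"

definition is_inverse :: "'a monoid \<Rightarrow> 'a \<Rightarrow> 'a \<Rightarrow> bool" where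
  "is_inverse G x x' \<longleftrightarrow>
     x \<in> carrier G \<and> x' \<in> carrier G \<and>
     x \<otimes>\<^bsub>G\<^esub> x' = \<one>\<^bsub>G\<^esub> \<and> x' \<otimes>\<^bsub>G\<^esub> x = \<one>\<^bsub>G\<^esub>"

text \<open>
  Inverses are treated as a relation because they may fail to exist, and without associativity
  they need not be unique a priori. The equation \<open>(xy)\<^sup>-\<^sup>1 = x\<^sup>-\<^sup>1y\<^sup>-\<^sup>1\<close> is imposed exactly when
  all three inverses exist. The predicate is meant for structures that are neutrosophic loops
  by construction; it adds the two Bruck conditions.
\<close>

definition neutrosophic_bruck :: "'a neutro monoid \<Rightarrow> bool" where
  "neutrosophic_bruck G \<longleftrightarrow>
     (\<forall>x \<in> carrier G. \<forall>y \<in> carrier G. \<forall>z \<in> carrier G.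
        (x \<otimes>\<^bsub>G\<^esub> (y \<otimes>\<^bsub>G\<^esub> x)) \<otimes>\<^bsub>G\<^esub> z = x \<otimes>\<^bsub>G\<^esub> (y \<otimes>\<^bsub>G\<^esub> (x \<otimes>\<^bsub>G\<^esub> z))) \<and>
     (\<forall>x \<in> carrier G. \<forall>y \<in> carrier G. \<forall>x' y' w.
        is_inverse G x x' \<longrightarrow> is_inverse G y y' \<longrightarrow> is_inverse G (x \<otimes>\<^bsub>G\<^esub> y) w \<longrightarrow>
        w = x' \<otimes>\<^bsub>G\<^esub> y')"

end

theory Submission
  imports Defs
begin

text \<open>
  The obstruction is the Bol identity \<open>(x(yx))z = x(y(xz))\<close>, and it already appears among the
  elements of the underlying loop \<open>L\<^sub>n(m)\<close>. Indices are read as integers modulo \<open>n\<close>, so that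
  distinct indices multiply by the affine rule \<open>a \<cdot> b = m b - (m - 1) a\<close>, with \<open>n\<close> in the role
  of \<open>0\<close>.

  Take \<open>x = 0\<close> and \<open>y = 1\<close>. With \<open>z = x\<close> the right-hand side collapses, because \<open>x x = e\<close>, to
  \<open>x y = m\<close>, whereas the left-hand side is \<open>m (m - 1)\<^sup>2\<close>. The difference is
  \<open>m\<^sup>2 (m - 2)\<close>, and \<open>m\<close> is a unit modulo \<open>n\<close>, so \<open>m = 2\<close>: only one member of the class can
  satisfy this instance. For \<open>m = 2\<close> the rule is \<open>a \<cdot> b = 2 b - a\<close>, and \<open>z = y\<close> gives \<open>4\<close> on the
  left and \<open>6\<close> on the right; these are distinct modulo \<open>n > 3\<close>.
\<close>

text \<open>Every integer names an index; this removes the unique-description operator and the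
  representatives \<open>1, \<dots>, n\<close> from all computations.\<close>

definition idx_of_int :: "nat \<Rightarrow> int \<Rightarrow> elt" where
  "idx_of_int n a = Idx (THE s. s \<in> {1..n} \<and> [int s = a] (mod int n))"

lemma idx_of_int_obtain:
  assumes "n > 0"
  obtains s where "idx_of_int n a = Idx s" "s \<in> {1..n}" "[int s = a] (mod int n)"
  using theI'[OF ex1_residue[OF assms, of a]] that unfolding idx_of_int_def by blast

lemma idx_of_int_eq_iff:
  assumes "n > 0"
  shows "idx_of_int n a = idx_of_int n b \<longleftrightarrow> int n dvd a - b"
proof -
  obtain s where s: "idx_of_int n a = Idx s" "[int s = a] (mod int n)"
    using idx_of_int_obtain[OF assms] by metis
  obtain t where t: "idx_of_int n b = Idx t" "[int t = b] (mod int n)"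
    using idx_of_int_obtain[OF assms] by metis
  have "idx_of_int n a = idx_of_int n b" if "[a = b] (mod int n)"
    using that unfolding idx_of_int_def by (simp add: cong_def)
  moreover have "[a = b] (mod int n)" if "idx_of_int n a = idx_of_int n b"
    using that s t by (metis cong_sym cong_trans elt.inject)
  ultimately show ?thesis by (auto simp: cong_iff_dvd_diff)
qed

lemma idx_of_int_in_carrier:
  "n > 0 \<Longrightarrow> idx_of_int n a \<in> carrier (L n m)"
  by (rule idx_of_int_obtain[of n a]) (auto simp: L_def)

lemma L_mult_idx_of_int:
  assumes "n > 0" and "\<not> int n dvd a - b"
  shows "L_mult n m (idx_of_int n a) (idx_of_int n b)
           = idx_of_int n (int m * b - (int m - 1) * a)"
proof -
  obtain s where s: "idx_of_int n a = Idx s" "[int s = a] (mod int n)"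
    using idx_of_int_obtain[OF assms(1)] by metis
  obtain t where t: "idx_of_int n b = Idx t" "[int t = b] (mod int n)"
    using idx_of_int_obtain[OF assms(1)] by metis
  have "s \<noteq> t"
    using idx_of_int_eq_iff[OF assms(1), of a b] assms(2) s(1) t(1) by auto
  moreover have "[int m * int t - (int m - 1) * int s
                   = int m * b - (int m - 1) * a] (mod int n)"
    by (intro cong_diff cong_mult cong_refl s t)
  ultimately show ?thesis
    unfolding s(1) t(1) by (simp add: idx_of_int_def cong_def)
qed

lemma L_mult_idx_of_int_self:
  "n > 0 \<Longrightarrow> L_mult n m (idx_of_int n a) (idx_of_int n a) = Unit"
  by (simp add: idx_of_int_def)

lemma L_mult_idx_of_int_Unit:
  "L_mult n m (idx_of_int n a) Unit = idx_of_int n a"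
  by (simp add: idx_of_int_def)

text \<open>The embedding \<open>Pure\<close> is multiplicative, so the Bol identity descends to the underlying loop.\<close>

lemma neutrosophic_bruck_imp_bol:
  assumes "neutrosophic_bruck (neutrosophic_loop G)"
    and "x \<in> carrier G" "y \<in> carrier G" "z \<in> carrier G"
  shows "(x \<otimes>\<^bsub>G\<^esub> (y \<otimes>\<^bsub>G\<^esub> x)) \<otimes>\<^bsub>G\<^esub> z = x \<otimes>\<^bsub>G\<^esub> (y \<otimes>\<^bsub>G\<^esub> (x \<otimes>\<^bsub>G\<^esub> z))"
proof -
  let ?N = "neutrosophic_loop G"
  have "Pure v \<in> carrier ?N" if "v \<in> carrier G" for v
    using that by (simp add: neutrosophic_loop_def)
  with assms have "(Pure x \<otimes>\<^bsub>?N\<^esub> (Pure y \<otimes>\<^bsub>?N\<^esub> Pure x)) \<otimes>\<^bsub>?N\<^esub> Pure z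
               = Pure x \<otimes>\<^bsub>?N\<^esub> (Pure y \<otimes>\<^bsub>?N\<^esub> (Pure x \<otimes>\<^bsub>?N\<^esub> Pure z))"
    unfolding neutrosophic_bruck_def by simp
  then show ?thesis by (simp add: neutrosophic_loop_def)
qed

text \<open>The instance \<open>z = x\<close>, with \<open>x = 0\<close> and \<open>y = 1\<close>. Coprimality of \<open>m - 1\<close> and of \<open>m\<close> to \<open>n\<close>
  keeps the factors of each product distinct, so that the affine rule applies throughout.\<close>

lemma bol_imp_eq_2:
  assumes n: "n > 1" and m: "0 < m" "m < n" "coprime m n" "coprime (m - 1) n"
    and bol: "\<And>x y z. x \<in> carrier (L n m) \<Longrightarrow> y \<in> carrier (L n m) \<Longrightarrow> z \<in> carrier (L n m) \<Longrightarrow>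
      L_mult n m (L_mult n m x (L_mult n m y x)) z
        = L_mult n m x (L_mult n m y (L_mult n m x z))"
  shows "m = 2"
proof -
  have n0: "n > 0" using n by simp
  let ?P = "idx_of_int n" and ?m = "int m"
  note mult = L_mult_idx_of_int[OF n0, where m = m]
  have cop: "coprime ?m (int n)" "coprime (?m - 1) (int n)"
    using m(3,4) coprime_int_iff[of m n] coprime_int_iff[of "m - 1" n] m(1)
    by (simp_all add: of_nat_diff Suc_leI)
  have not1: "\<not> int n dvd 1" using n by simp
  have neg: "\<not> int n dvd ?m - 1"
    using cop(2) not1 by (meson coprime_common_divisor dvd_refl)
  have prod: "\<not> int n dvd ?m * (?m - 1)"
    using cop(1) neg by (metis coprime_commute coprime_dvd_mult_right_iff)
  have yx: "L_mult n m (?P 1) (?P 0) = ?P (1 - ?m)"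
    using mult[of 1 0] not1 by simp
  have xyx: "L_mult n m (?P 0) (?P (1 - ?m)) = ?P (?m * (1 - ?m))"
    using mult[of 0 "1 - ?m"] neg by (simp add: dvd_diff_commute)
  have "?m * (1 - ?m) = - (?m * (?m - 1))"
    by (simp add: algebra_simps)
  then have "\<not> int n dvd ?m * (1 - ?m)"
    using prod by (metis dvd_minus_iff)
  then have lhs: "L_mult n m (?P (?m * (1 - ?m))) (?P 0) = ?P (- ((?m - 1) * (?m * (1 - ?m))))"
    using mult[of "?m * (1 - ?m)" 0] by simp
  have xy: "L_mult n m (?P 0) (?P 1) = ?P ?m"
    using mult[of 0 1] not1 by simp
  have "?P (- ((?m - 1) * (?m * (1 - ?m)))) = ?P ?m"
    using bol[OF idx_of_int_in_carrier[OF n0, of 0] idx_of_int_in_carrier[OF n0, of 1]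
        idx_of_int_in_carrier[OF n0, of 0]]
    by (simp only: yx xyx lhs xy L_mult_idx_of_int_self[OF n0] L_mult_idx_of_int_Unit)
  then have "int n dvd - ((?m - 1) * (?m * (1 - ?m))) - ?m"
    using idx_of_int_eq_iff[OF n0] by blast
  also have "- ((?m - 1) * (?m * (1 - ?m))) - ?m = ?m * (?m * (?m - 2))"
    by (simp add: algebra_simps)
  finally have dvd: "int n dvd ?m - 2"
    using cop(1) by (metis coprime_commute coprime_dvd_mult_right_iff)
  have "m \<noteq> 1" using m(4) n by auto
  then have "\<bar>?m - 2\<bar> < int n" using m by linarith
  with dvd have "?m - 2 = 0"
    using dvd_imp_le_int[of "?m - 2" "int n"] by linarith
  then show ?thesis by simp
qed

text \<open>The instance \<open>z = y\<close>, with \<open>x = 0\<close> and \<open>y = 1\<close>. The left-hand side passes through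
  \<open>-2 \<cdot> 1\<close> and the right-hand side through \<open>0 \<cdot> 3\<close>, where \<open>n > 3\<close> rules out equal factors.\<close>

lemma not_bol_L_2:
  assumes n: "n > 3"
  obtains x y z where "x \<in> carrier (L n 2)" "y \<in> carrier (L n 2)" "z \<in> carrier (L n 2)"
    "L_mult n 2 (L_mult n 2 x (L_mult n 2 y x)) z
       \<noteq> L_mult n 2 x (L_mult n 2 y (L_mult n 2 x z))"
proof -
  have n0: "n > 0" using n by simp
  let ?P = "idx_of_int n"
  note mult = L_mult_idx_of_int[OF n0, where m = 2, simplified]
  have small: "\<not> int n dvd 1" "\<not> int n dvd 2" "\<not> int n dvd 3"
    using n by (auto dest!: zdvd_imp_le)
  have "L_mult n 2 (?P 1) (?P 0) = ?P (-1)"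
    using mult[of 1 0] small by simp
  moreover have "L_mult n 2 (?P 0) (?P (-1)) = ?P (-2)"
    using mult[of 0 "-1"] small by simp
  moreover have "L_mult n 2 (?P (-2)) (?P 1) = ?P 4"
    using mult[of "-2" 1] small by simp
  moreover have "L_mult n 2 (?P 0) (?P 1) = ?P 2"
    using mult[of 0 1] small by simp
  moreover have "L_mult n 2 (?P 1) (?P 2) = ?P 3"
    using mult[of 1 2] small by simp
  moreover have "L_mult n 2 (?P 0) (?P 3) = ?P 6"
    using mult[of 0 3] small by simp
  moreover have "?P 4 \<noteq> ?P 6"
    using idx_of_int_eq_iff[OF n0, of 4 6] small by simp
  ultimately show ?thesis
    using that[of "?P 0" "?P 1" "?P 1"] idx_of_int_in_carrier[OF n0] by simp
qed

theorem theorem4p1p12: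
  fixes n :: nat
  assumes "n > 3" and "odd n"
  shows "\<not> (\<exists>G \<in> neutrosophic_L_class n. neutrosophic_bruck G)"
proof
  assume "\<exists>G \<in> neutrosophic_L_class n. neutrosophic_bruck G"
  then obtain m where bruck: "neutrosophic_bruck (neutrosophic_loop (L n m))"
    and m: "0 < m" "m < n" "coprime m n" "coprime (m - 1) n"
    by (auto simp: neutrosophic_L_class_def coprime_iff_gcd_eq_1)
  have bol: "L_mult n m (L_mult n m x (L_mult n m y x)) z
               = L_mult n m x (L_mult n m y (L_mult n m x z))"
    if "x \<in> carrier (L n m)" "y \<in> carrier (L n m)" "z \<in> carrier (L n m)" for x y z
    using neutrosophic_bruck_imp_bol[OF bruck that] by (simp add: L_def)
  have "m = 2"
    using bol_imp_eq_2[OF _ m bol] assms(1) by simp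
  with bol not_bol_L_2[OF assms(1)] show False by metis
qed

end
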